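(* Let $(\mathcal{M},g)$ be a paracompact, connected, pseudo-Riemannian manifold of dimension $n=p+q$ and signature $(p,q)$, let $U\subseteq\mathcal{M}$ be an open set with a local orthonormal coframe $\{e^1,\dots,e^n\}$ of $T^{*}\mathcal{M}$, and let $\mathbf{v}=e^1\wedge e^2\wedge\cdots\wedge e^n$ be the volume element. Then, with respect to the Graf product $\diamond$, $$\mathbf{v}\diamond\mathbf{v}=\begin{cases}+1_\Gamma,&\text{if } p-q\equiv 0,1 \pmod 4 \ (\Leftrightarrow\ p-q\equiv 0,1,4,5 \pmod 8),\\ -1_\Gamma,&\text{if } p-q\equiv 2,3\pmod 4 \ (\Leftrightarrow\ p-q\equiv 2,3,6,7 \pmod 8).\end{cases}$$
   Context: The constant function $1$ on $U$, viewed as a $0$-form, is denoted $1_\Gamma$. Let $\{e_1,\dots,e_n\}$ be the frame of $T\mathcal{M}$ over $U$ dual to $\{e^i\}$, so $e^i(e_j)=\delta^i_j$. Let $g^{*}$ be the metric induced by $g$ on $T^{*}\mathcal{M}$ and $g^{ij}=g^{*}(e^i,e^j)$; orthonormal means $g^{ij}=0$ for $i\ne j$, $g^{ii}=1$ for $1\le i\le p$ and $g^{ii}=-1$ for $p+1\le i\le n$. $e_i\rfloor$ denotes contraction (interior product) on forms: the linear map of degree $-1$ vanishing on $0$-forms with $e_i\rfloor e^j=\delta_i^j 1_\Gamma$ and $e_i\rfloor(\alpha\wedge\beta)=(e_i\rfloor\alpha)\wedge\beta+(-1)^{\deg\alpha}\alpha\wedge(e_i\rfloor\beta)$. The contracted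 wedge product of order $l\ge 0$ on $\Gamma(U,\bigwedge(T^{*}\mathcal{M}))$ is defined iteratively by $f_1\wedge_0 f_2=f_1\wedge f_2$ and $f_1\wedge_l f_2=\sum_{i,j=1}^n g^{ij}(e_i\rfloor f_1)\wedge_{l-1}(e_j\rfloor f_2)$ for $l\ge1$. The Graf product $\diamond$ is the bilinear product on $\Gamma(U,\bigwedge(T^{*}\mathcal{M}))$ defined for an $r$-form $f_1$ and an $s$-form $f_2$ with $r\le s$ by $$f_1\diamond f_2=\sum_{l=0}^r\frac{(-1)^{l(r-l)+[l/2]}}{l!}f_1\wedge_l f_2,\qquad f_2\diamond f_1=(-1)^{rs}\sum_{l=0}^r\frac{(-1)^{l(r-l+1)+[l/2]}}{l!}f_1\wedge_l f_2,$$ where $[x]$ is the integer part of $x$. *)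

theory Defs
  imports "HOL-Analysis.Analysis" "HOL-Library.Function_Algebras"
begin

text \<open>
  Real-valued functions are added and multiplied pointwise (\<open>HOL-Library.Function_Algebras\<close>);
  this applies in particular to tangent vectors and to differential forms, which are
  encoded as (curried) real-valued functions below.
\<close>

section \<open>Smooth manifolds\<close>

definition paracompact_space :: "'a topology \<Rightarrow> bool" where
  "paracompact_space X \<longleftrightarrow>
     (\<forall>\<U>. (\<forall>B\<in>\<U>. openin X B) \<and> topspace X \<subseteq> \<Union>\<U> \<longrightarrow>
        (\<exists>\<V>. (\<forall>B\<in>\<V>. openin X B \<and> (\<exists>C\<in>\<U>. B \<subseteq> C)) \<and> topspace X \<subseteq> \<Union>\<V> \<and> locally_finite_in X \<V>))"

text \<open>
  \<open>Euclidean_space n\<close> consists of the functions \<open>nat \<Rightarrow> real\<close> supported on \<open>{..<n}\<close>, so the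
  coordinates on \<open>\<real>\<^sup>n\<close> are numbered from 0.
\<close>

definition partial_deriv :: "nat \<Rightarrow> ((nat \<Rightarrow> real) \<Rightarrow> real) \<Rightarrow> (nat \<Rightarrow> real) \<Rightarrow> real" where
  "partial_deriv i f x = deriv (\<lambda>t. f (x(i := t))) (x i)"

text \<open>Only meaningful for \<open>S\<close> open in \<open>Euclidean_space n\<close>.\<close>

primrec Ck_on :: "nat \<Rightarrow> nat \<Rightarrow> (nat \<Rightarrow> real) set \<Rightarrow> ((nat \<Rightarrow> real) \<Rightarrow> real) \<Rightarrow> bool" where
  "Ck_on n 0 S f \<longleftrightarrow> continuous_map (subtopology (Euclidean_space n) S) euclideanreal f"
| "Ck_on n (Suc k) S f \<longleftrightarrow>
     continuous_map (subtopology (Euclidean_space n) S) euclideanreal f \<and>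
     (\<forall>i<n. (\<forall>x\<in>S. (\<lambda>t. f (x(i := t))) differentiable (at (x i))) \<and>
            Ck_on n k S (partial_deriv i f))"

definition Cinf_on :: "nat \<Rightarrow> (nat \<Rightarrow> real) set \<Rightarrow> ((nat \<Rightarrow> real) \<Rightarrow> real) \<Rightarrow> bool" where
  "Cinf_on n S f \<longleftrightarrow> (\<forall>k. Ck_on n k S f)"

text \<open>An atlas is a set of charts, each given by its domain and its coordinate map.\<close>

type_synonym 'a atlas = "('a set \<times> ('a \<Rightarrow> nat \<Rightarrow> real)) set"

definition smooth_atlas :: "'a topology \<Rightarrow> nat \<Rightarrow> 'a atlas \<Rightarrow> bool" where
  "smooth_atlas M n A \<longleftrightarrow>
     (\<Union>(V, \<phi>)\<in>A. V) = topspace M \<and>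
     (\<forall>(V, \<phi>)\<in>A. openin M V \<and> openin (Euclidean_space n) (\<phi> ` V) \<and>
        homeomorphic_map (subtopology M V) (subtopology (Euclidean_space n) (\<phi> ` V)) \<phi>) \<and>
     (\<forall>(V, \<phi>)\<in>A. \<forall>(W, \<psi>)\<in>A. \<forall>i<n. Cinf_on n (\<phi> ` (V \<inter> W)) (\<lambda>y. \<psi> (inv_into V \<phi> y) i))"

definition smooth_manifold :: "'a topology \<Rightarrow> nat \<Rightarrow> 'a atlas \<Rightarrow> bool" where
  "smooth_manifold M n A \<longleftrightarrow> Hausdorff_space M \<and> smooth_atlas M n A"

definition smooth_on :: "nat \<Rightarrow> 'a atlas \<Rightarrow> 'a set \<Rightarrow> ('a \<Rightarrow> real) \<Rightarrow> bool" where
  "smooth_on n A U f \<longleftrightarrow> (\<forall>(V, \<phi>)\<in>A. Cinf_on n (\<phi> ` (V \<inter> U)) (\<lambda>y. f (inv_into V \<phi> y)))"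

definition smooth_functions :: "nat \<Rightarrow> 'a atlas \<Rightarrow> ('a \<Rightarrow> real) set" where
  "smooth_functions n A = {f. smooth_on n A (\<Union>(V, \<phi>)\<in>A. V) f}"

section \<open>Tangent and cotangent spaces\<close>

text \<open>
  Tangent vectors at \<open>x\<close> are the derivations at \<open>x\<close> of the algebra of smooth functions on the
  manifold.  They are set to 0 on non-smooth functions, so that equality of tangent vectors is
  equality of functions.
\<close>

type_synonym 'a tvec = "('a \<Rightarrow> real) \<Rightarrow> real"

definition scale :: "real \<Rightarrow> ('z \<Rightarrow> real) \<Rightarrow> 'z \<Rightarrow> real" where
  "scale c v = (\<lambda>z. c * v z)"

definition tangent_space :: "nat \<Rightarrow> 'a atlas \<Rightarrow> 'a \<Rightarrow> 'a tvec set" where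
  "tangent_space n A x =
     {v. (\<forall>f\<in>smooth_functions n A. \<forall>h\<in>smooth_functions n A.
            v (f + h) = v f + v h \<and> v (f * h) = f x * v h + h x * v f) \<and>
         (\<forall>c. \<forall>f\<in>smooth_functions n A. v (scale c f) = c * v f) \<and>
         (\<forall>f. f \<notin> smooth_functions n A \<longrightarrow> v f = 0)}"

text \<open>\<open>b 1, \<dots>, b n\<close> is a basis of the linear space \<open>V\<close> of real-valued functions.\<close>

definition is_basis :: "('z \<Rightarrow> real) set \<Rightarrow> nat \<Rightarrow> (nat \<Rightarrow> 'z \<Rightarrow> real) \<Rightarrow> bool" where
  "is_basis V n b \<longleftrightarrow>
     (\<forall>i\<in>{1..n}. b i \<in> V) \<and>
     (\<forall>v\<in>V. \<exists>c. v = (\<Sum>i=1..n. scale (c i) (b i))) \<and>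
     (\<forall>c. (\<Sum>i=1..n. scale (c i) (b i)) = 0 \<longrightarrow> (\<forall>i\<in>{1..n}. c i = 0))"

text \<open>
  The exterior algebra of the cotangent space at \<open>x\<close>, as multilinear alternating functions of
  lists of tangent vectors: the restriction of \<open>\<omega>\<close> to lists of length \<open>k\<close> is the component of
  degree \<open>k\<close>, and it vanishes for \<open>k > n\<close>.  The value on lists which do not consist of tangent
  vectors at \<open>x\<close> is 0.
\<close>

type_synonym 'a altform = "'a tvec list \<Rightarrow> real"

definition exterior_algebra :: "nat \<Rightarrow> 'a atlas \<Rightarrow> 'a \<Rightarrow> 'a altform set" where
  "exterior_algebra n A x =
     {\<omega>. (\<forall>vs. \<not> set vs \<subseteq> tangent_space n A x \<longrightarrow> \<omega> vs = 0) \<and>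
         (\<forall>us\<in>lists (tangent_space n A x). \<forall>vs\<in>lists (tangent_space n A x).
          \<forall>v\<in>tangent_space n A x. \<forall>w\<in>tangent_space n A x. \<forall>a b.
            \<omega> (us @ (scale a v + scale b w) # vs) = a * \<omega> (us @ v # vs) + b * \<omega> (us @ w # vs)) \<and>
         (\<forall>us\<in>lists (tangent_space n A x). \<forall>vs\<in>lists (tangent_space n A x).
          \<forall>ws\<in>lists (tangent_space n A x). \<forall>v\<in>tangent_space n A x. \<omega> (us @ v # vs @ v # ws) = 0)}"

definition cotangent_space :: "nat \<Rightarrow> 'a atlas \<Rightarrow> 'a \<Rightarrow> 'a altform set" where
  "cotangent_space n A x = {\<omega>\<in>exterior_algebra n A x. \<forall>vs. length vs \<noteq> 1 \<longrightarrow> \<omega> vs = 0}"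

section \<open>Vector fields and differential forms\<close>

type_synonym 'a vfield = "'a \<Rightarrow> 'a tvec"
type_synonym 'a dform = "'a \<Rightarrow> 'a altform"

definition smooth_vfields :: "nat \<Rightarrow> 'a atlas \<Rightarrow> 'a set \<Rightarrow> 'a vfield set" where
  "smooth_vfields n A U =
     {X. (\<forall>x\<in>U. X x \<in> tangent_space n A x) \<and>
         (\<forall>f\<in>smooth_functions n A. smooth_on n A U (\<lambda>x. X x f))}"

text \<open>Smooth sections over \<open>U\<close> of the exterior algebra bundle, extended by 0 outside \<open>U\<close>.\<close>

definition diff_forms :: "nat \<Rightarrow> 'a atlas \<Rightarrow> 'a set \<Rightarrow> 'a dform set" where
  "diff_forms n A U =
     {\<omega>. (\<forall>x\<in>U. \<omega> x \<in> exterior_algebra n A x) \<and> (\<forall>x. x \<notin> U \<longrightarrow> \<omega> x = 0) \<and>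
         (\<forall>Xs\<in>lists (smooth_vfields n A U). smooth_on n A U (\<lambda>x. \<omega> x (map (\<lambda>X. X x) Xs)))}"

definition form_degree :: "nat \<Rightarrow> 'a dform \<Rightarrow> bool" where
  "form_degree k \<omega> \<longleftrightarrow> (\<forall>x vs. length vs \<noteq> k \<longrightarrow> \<omega> x vs = 0)"

definition degree_part :: "nat \<Rightarrow> 'a dform \<Rightarrow> 'a dform" where
  "degree_part k \<omega> = (\<lambda>x vs. if length vs = k then \<omega> x vs else 0)"

definition fscale :: "('a \<Rightarrow> real) \<Rightarrow> 'a dform \<Rightarrow> 'a dform" where
  "fscale c \<omega> = (\<lambda>x. scale (c x) (\<omega> x))"

definition unit_form :: "'a set \<Rightarrow> 'a dform" where
  "unit_form U = (\<lambda>x vs. if x \<in> U \<and> vs = [] then 1 else 0)"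

text \<open>
  The exterior product, as the sum over all shuffles (with the normalisation
  \<open>(\<alpha> \<and> \<beta>)(v, w) = \<alpha>(v) \<beta>(w) - \<alpha>(w) \<beta>(v)\<close> for 1-forms).  A shuffle is given by the set \<open>S\<close> of
  the positions of the arguments passed to the first factor, and its sign by the number of
  inversions.
\<close>

definition inversions :: "nat \<Rightarrow> nat set \<Rightarrow> (nat \<times> nat) set" where
  "inversions m S = {(i, j). i \<in> S \<and> j \<in> {..<m} - S \<and> j < i}"

definition wedge :: "'a dform \<Rightarrow> 'a dform \<Rightarrow> 'a dform" where
  "wedge \<alpha> \<beta> = (\<lambda>x vs. \<Sum>S\<in>Pow {..<length vs}.
     (-1) ^ card (inversions (length vs) S) * \<alpha> x (nths vs S) * \<beta> x (nths vs (- S)))"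

definition contract :: "'a vfield \<Rightarrow> 'a dform \<Rightarrow> 'a dform" where
  "contract X \<omega> = (\<lambda>x vs. \<omega> x (X x # vs))"

section \<open>Pseudo-Riemannian metrics and coframes\<close>

definition pseudo_riemannian_metric ::
    "'a topology \<Rightarrow> 'a atlas \<Rightarrow> nat \<Rightarrow> nat \<Rightarrow> ('a \<Rightarrow> 'a tvec \<Rightarrow> 'a tvec \<Rightarrow> real) \<Rightarrow> bool" where
  "pseudo_riemannian_metric M A p q g \<longleftrightarrow>
     (\<forall>x\<in>topspace M.
        (\<forall>u\<in>tangent_space (p+q) A x. \<forall>v\<in>tangent_space (p+q) A x. g x u v = g x v u) \<and>
        (\<forall>u\<in>tangent_space (p+q) A x. \<forall>v\<in>tangent_space (p+q) A x. \<forall>w\<in>tangent_space (p+q) A x. \<forall>a b.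
           g x (scale a u + scale b v) w = a * g x u w + b * g x v w) \<and>
        (\<forall>u\<in>tangent_space (p+q) A x. (\<forall>v\<in>tangent_space (p+q) A x. g x u v = 0) \<longrightarrow> u = 0) \<and>
        (\<exists>b. is_basis (tangent_space (p+q) A x) (p+q) b \<and>
           (\<forall>i\<in>{1..p+q}. \<forall>j\<in>{1..p+q}.
              g x (b i) (b j) = (if i \<noteq> j then 0 else if i \<le> p then 1 else -1)))) \<and>
     (\<forall>X\<in>smooth_vfields (p+q) A (topspace M). \<forall>Y\<in>smooth_vfields (p+q) A (topspace M).
        smooth_on (p+q) A (topspace M) (\<lambda>x. g x (X x) (Y x)))"

definition sharp :: "nat \<Rightarrow> 'a atlas \<Rightarrow> ('a \<Rightarrow> 'a tvec \<Rightarrow> 'a tvec \<Rightarrow> real) \<Rightarrow> 'a \<Rightarrow> 'a altform \<Rightarrow> 'a tvec" where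
  "sharp n A g x \<alpha> = (THE v. v \<in> tangent_space n A x \<and> (\<forall>w\<in>tangent_space n A x. g x v w = \<alpha> [w]))"

definition cometric :: "nat \<Rightarrow> 'a atlas \<Rightarrow> ('a \<Rightarrow> 'a tvec \<Rightarrow> 'a tvec \<Rightarrow> real) \<Rightarrow> 'a \<Rightarrow> 'a altform \<Rightarrow> 'a altform \<Rightarrow> real" where
  "cometric n A g x \<alpha> \<beta> = g x (sharp n A g x \<alpha>) (sharp n A g x \<beta>)"

definition local_coframe :: "nat \<Rightarrow> 'a atlas \<Rightarrow> 'a set \<Rightarrow> (nat \<Rightarrow> 'a dform) \<Rightarrow> bool" where
  "local_coframe n A U e \<longleftrightarrow>
     (\<forall>i\<in>{1..n}. e i \<in> diff_forms n A U \<and> form_degree 1 (e i)) \<and>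
     (\<forall>x\<in>U. is_basis (cotangent_space n A x) n (\<lambda>i. e i x))"

definition orthonormal_coframe ::
    "nat \<Rightarrow> nat \<Rightarrow> 'a atlas \<Rightarrow> ('a \<Rightarrow> 'a tvec \<Rightarrow> 'a tvec \<Rightarrow> real) \<Rightarrow> 'a set \<Rightarrow> (nat \<Rightarrow> 'a dform) \<Rightarrow> bool" where
  "orthonormal_coframe p q A g U e \<longleftrightarrow>
     local_coframe (p+q) A U e \<and>
     (\<forall>x\<in>U. \<forall>i\<in>{1..p+q}. \<forall>j\<in>{1..p+q}.
        cometric (p+q) A g x (e i x) (e j x) = (if i \<noteq> j then 0 else if i \<le> p then 1 else -1))"

definition dual_frame :: "nat \<Rightarrow> 'a atlas \<Rightarrow> 'a set \<Rightarrow> (nat \<Rightarrow> 'a dform) \<Rightarrow> (nat \<Rightarrow> 'a vfield) \<Rightarrow> bool" where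
  "dual_frame n A U e E \<longleftrightarrow>
     (\<forall>i\<in>{1..n}. E i \<in> smooth_vfields n A U) \<and>
     (\<forall>x\<in>U. is_basis (tangent_space n A x) n (\<lambda>i. E i x)) \<and>
     (\<forall>x\<in>U. \<forall>i\<in>{1..n}. \<forall>j\<in>{1..n}. e i x [E j x] = (if i = j then 1 else 0))"

definition volume_form :: "nat \<Rightarrow> 'a set \<Rightarrow> (nat \<Rightarrow> 'a dform) \<Rightarrow> 'a dform" where
  "volume_form n U e = foldr wedge (map e [1..<Suc n]) (unit_form U)"

section \<open>The Graf product\<close>

primrec contracted_wedge ::
    "nat \<Rightarrow> 'a atlas \<Rightarrow> ('a \<Rightarrow> 'a tvec \<Rightarrow> 'a tvec \<Rightarrow> real) \<Rightarrow> (nat \<Rightarrow> 'a dform) \<Rightarrow> (nat \<Rightarrow> 'a vfield) \<Rightarrow>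
     nat \<Rightarrow> 'a dform \<Rightarrow> 'a dform \<Rightarrow> 'a dform" where
  "contracted_wedge n A g e E 0 \<alpha> \<beta> = wedge \<alpha> \<beta>"
| "contracted_wedge n A g e E (Suc l) \<alpha> \<beta> =
     (\<Sum>i=1..n. \<Sum>j=1..n. fscale (\<lambda>x. cometric n A g x (e i x) (e j x))
        (contracted_wedge n A g e E l (contract (E i) \<alpha>) (contract (E j) \<beta>)))"

text \<open>
  The Graf product of an \<open>r\<close>-form and an \<open>s\<close>-form.  For \<open>r = s\<close> both of the defining formulas
  apply and agree; the first one is used.
\<close>

definition graf_homogeneous ::
    "nat \<Rightarrow> 'a atlas \<Rightarrow> ('a \<Rightarrow> 'a tvec \<Rightarrow> 'a tvec \<Rightarrow> real) \<Rightarrow> (nat \<Rightarrow> 'a dform) \<Rightarrow> (nat \<Rightarrow> 'a vfield) \<Rightarrow>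
     nat \<Rightarrow> nat \<Rightarrow> 'a dform \<Rightarrow> 'a dform \<Rightarrow> 'a dform" where
  "graf_homogeneous n A g e E r s \<alpha> \<beta> =
     (if r \<le> s
      then \<Sum>l=0..r. fscale (\<lambda>_. (-1) ^ (l * (r - l) + l div 2) / fact l)
             (contracted_wedge n A g e E l \<alpha> \<beta>)
      else fscale (\<lambda>_. (-1) ^ (r * s))
             (\<Sum>l=0..s. fscale (\<lambda>_. (-1) ^ (l * (s - l + 1) + l div 2) / fact l)
                (contracted_wedge n A g e E l \<beta> \<alpha>)))"

definition graf_product ::
    "nat \<Rightarrow> 'a atlas \<Rightarrow> ('a \<Rightarrow> 'a tvec \<Rightarrow> 'a tvec \<Rightarrow> real) \<Rightarrow> (nat \<Rightarrow> 'a dform) \<Rightarrow> (nat \<Rightarrow> 'a vfield) \<Rightarrow>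
     'a dform \<Rightarrow> 'a dform \<Rightarrow> 'a dform" where
  "graf_product n A g e E \<alpha> \<beta> =
     (\<Sum>r=0..n. \<Sum>s=0..n. graf_homogeneous n A g e E r s (degree_part r \<alpha>) (degree_part s \<beta>))"

section \<open>Characteristic properties of the contraction\<close>

lemma contract_0_form:
  assumes "form_degree 0 \<omega>" shows "contract X \<omega> = 0"
  using assms by (auto simp: form_degree_def contract_def fun_eq_iff)

lemma contract_degree:
  assumes "form_degree (Suc k) \<omega>" shows "form_degree k (contract X \<omega>)"
  using assms by (auto simp: form_degree_def contract_def)

lemma contract_linear:
  "contract X (\<alpha> + \<beta>) = contract X \<alpha> + contract X \<beta>"
  "contract X (fscale c \<alpha>) = fscale c (contract X \<alpha>)"
  by (auto simp: contract_def fscale_def scale_def fun_eq_iff)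

lemma contract_coframe:
  assumes e: "local_coframe n A U e" and E: "dual_frame n A U e E"
    and ij: "i \<in> {1..n}" "j \<in> {1..n}"
  shows "contract (E i) (e j) = (if i = j then unit_form U else 0)"
proof (intro ext)
  fix x vs
  have "e j \<in> diff_forms n A U" "form_degree 1 (e j)"
    using e ij by (auto simp: local_coframe_def)
  then have deg: "e j x ws = 0" if "length ws \<noteq> 1 \<or> x \<notin> U" for ws
    using that by (auto simp: diff_forms_def form_degree_def)
  have "e j x [E i x] = (if i = j then 1 else 0)" if "x \<in> U"
    using E ij that by (auto simp: dual_frame_def)
  then show "contract (E i) (e j) x vs = (if i = j then unit_form U else 0) x vs"
    using deg[of "E i x # vs"] by (cases vs) (auto simp: contract_def unit_form_def)
qed

lemma inversions_Suc:
  assumes "T \<subseteq> {..<m}"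
  shows "card (inversions (Suc m) (insert 0 (Suc ` T))) = card (inversions m T)" (is ?A)
    and "card (inversions (Suc m) (Suc ` T)) = card T + card (inversions m T)" (is ?B)
proof -
  let ?f = "\<lambda>(i, j). (Suc i, Suc j)"
  have inj: "inj_on ?f X" for X by (auto simp: inj_on_def)
  have finT: "finite T" using assms finite_subset by blast
  have fin: "finite (inversions m T)"
    by (rule finite_subset[of _ "T \<times> {..<m}"]) (use finT in \<open>auto simp: inversions_def\<close>)
  have im: "(Suc i, Suc j) \<in> ?f ` X \<longleftrightarrow> (i, j) \<in> X" "(0, j) \<notin> ?f ` X" "(i, 0) \<notin> ?f ` X" for i j X
    by force+
  have "inversions (Suc m) (insert 0 (Suc ` T)) = ?f ` inversions m T"
  proof (intro set_eqI, clarify)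
    fix i j
    show "((i, j) \<in> inversions (Suc m) (insert 0 (Suc ` T))) = ((i, j) \<in> ?f ` inversions m T)"
      by (cases i; cases j) (simp_all add: im, auto simp: inversions_def)
  qed
  then show ?A by (simp add: card_image inj)
  have "inversions (Suc m) (Suc ` T) = (\<lambda>i. (Suc i, 0)) ` T \<union> ?f ` inversions m T"
  proof (intro set_eqI, clarify)
    fix i j
    show "((i, j) \<in> inversions (Suc m) (Suc ` T)) =
        ((i, j) \<in> (\<lambda>i. (Suc i, 0)) ` T \<union> ?f ` inversions m T)"
      by (cases i; cases j) (simp_all add: im, auto simp: inversions_def)
  qed
  moreover have "(\<lambda>i. (Suc i, 0)) ` T \<inter> ?f ` inversions m T = {}" by auto
  moreover have "card ((\<lambda>i. (Suc i, 0 :: nat)) ` T) = card T"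
    by (simp add: card_image inj_on_def)
  ultimately show ?B
    using finT fin by (simp add: card_Un_disjoint card_image[OF inj])
qed

lemma Pow_lessThan_Suc_shift:
  "Pow {..<Suc m} = (\<lambda>T. insert 0 (Suc ` T)) ` Pow {..<m} \<union> image Suc ` Pow {..<m}"
proof (intro equalityI subsetI)
  fix S assume S: "S \<in> Pow {..<Suc m}"
  define T where "T = {i. Suc i \<in> S}"
  have "T \<in> Pow {..<m}" using S by (auto simp: T_def)
  moreover have "S = (if 0 \<in> S then insert 0 (Suc ` T) else Suc ` T)"
  proof (intro set_eqI)
    fix i show "i \<in> S \<longleftrightarrow> i \<in> (if 0 \<in> S then insert 0 (Suc ` T) else Suc ` T)"
      by (cases i) (auto simp: T_def)
  qed
  ultimately show "S \<in> (\<lambda>T. insert 0 (Suc ` T)) ` Pow {..<m} \<union> image Suc ` Pow {..<m}"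
    by (metis (mono_tags, lifting) UnCI imageI)
qed auto

lemma wedge_Cons:
  "wedge \<alpha> \<beta> x (v # vs) =
     (\<Sum>T\<in>Pow {..<length vs}. (-1) ^ card (inversions (length vs) T) *
        \<alpha> x (v # nths vs T) * \<beta> x (nths vs (- T))) +
     (\<Sum>T\<in>Pow {..<length vs}. (-1) ^ (card T + card (inversions (length vs) T)) *
        \<alpha> x (nths vs T) * \<beta> x (v # nths vs (- T)))"
proof -
  let ?m = "length vs"
  let ?F = "\<lambda>S. (-1) ^ card (inversions (Suc ?m) S) * \<alpha> x (nths (v # vs) S) * \<beta> x (nths (v # vs) (- S))"
  let ?i = "\<lambda>T. insert 0 (Suc ` T)"
  have inj1: "inj_on ?i (Pow {..<?m})"
  proof (rule inj_onI)
    fix T T' assume "?i T = ?i T'"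
    then have "?i T - {0} = ?i T' - {0}" by simp
    then show "T = T'" by (simp add: inj_image_eq_iff)
  qed
  have inj2: "inj_on (image Suc) (Pow {..<?m})"
    by (auto simp: inj_on_def inj_image_eq_iff)
  have "wedge \<alpha> \<beta> x (v # vs) = sum ?F (Pow {..<Suc ?m})"
    by (simp add: wedge_def)
  also have "\<dots> = sum ?F (?i ` Pow {..<?m}) + sum ?F (image Suc ` Pow {..<?m})"
    unfolding Pow_lessThan_Suc_shift by (rule sum.union_disjoint) auto
  also have "\<dots> = (\<Sum>T\<in>Pow {..<?m}. ?F (?i T)) + (\<Sum>T\<in>Pow {..<?m}. ?F (Suc ` T))"
    by (simp add: sum.reindex[OF inj1] sum.reindex[OF inj2])
  finally have "wedge \<alpha> \<beta> x (v # vs) = \<dots>" .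
  moreover have "{j. Suc j \<notin> Suc ` T} = - T" for T by auto
  ultimately show ?thesis
    by (simp add: nths_Cons inversions_Suc image_iff[of 0] inj_image_mem_iff Compl_eq)
qed

lemma contract_wedge:
  assumes "form_degree k \<alpha>"
  shows "contract X (wedge \<alpha> \<beta>) =
    wedge (contract X \<alpha>) \<beta> + fscale (\<lambda>_. (-1) ^ k) (wedge \<alpha> (contract X \<beta>))"
proof (intro ext)
  fix x vs
  have card: "\<alpha> x (nths vs T) = 0" if "T \<subseteq> {..<length vs}" "card T \<noteq> k" for T
  proof -
    have "{i. i < length vs \<and> i \<in> T} = T" using that by auto
    then have "length (nths vs T) \<noteq> k" using that by (simp add: length_nths)
    then show ?thesis using assms by (simp add: form_degree_def)
  qed
  have "(\<Sum>T\<in>Pow {..<length vs}. (-1) ^ (card T + card (inversions (length vs) T)) *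
          \<alpha> x (nths vs T) * \<beta> x (X x # nths vs (- T))) =
        (-1) ^ k * (\<Sum>T\<in>Pow {..<length vs}. (-1) ^ card (inversions (length vs) T) *
          \<alpha> x (nths vs T) * \<beta> x (X x # nths vs (- T)))"
    unfolding sum_distrib_left
  proof (rule sum.cong)
    fix T assume "T \<in> Pow {..<length vs}"
    then show "(-1) ^ (card T + card (inversions (length vs) T)) *
          \<alpha> x (nths vs T) * \<beta> x (X x # nths vs (- T)) =
        (-1) ^ k * ((-1) ^ card (inversions (length vs) T) *
          \<alpha> x (nths vs T) * \<beta> x (X x # nths vs (- T)))"
      using card[of T] by (cases "card T = k") (auto simp: power_add)
  qed simp
  then show "contract X (wedge \<alpha> \<beta>) x vs =
      (wedge (contract X \<alpha>) \<beta> + fscale (\<lambda>_. (-1) ^ k) (wedge \<alpha> (contract X \<beta>))) x vs"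
    by (simp add: contract_def wedge_Cons) (simp add: wedge_def fscale_def scale_def)
qed

end

theory Submission
  imports Defs
begin

text \<open>
  Write \<open>e\<^sup>J\<close> for the exterior product of the coframe elements \<open>e\<^sup>j\<close> along a list \<open>J\<close> of distinct
  indices, so that the volume form is \<open>e\<^sup>J\<close> for \<open>J = [1, \<dots>, n]\<close>.  Contraction with \<open>e\<^sub>i\<close> kills \<open>e\<^sup>J\<close>
  if \<open>i\<close> is not in \<open>J\<close>, and otherwise removes \<open>i\<close> from \<open>J\<close> up to a sign
  (\<open>contract_coframe_monomial_in\<close>).  In an orthonormal coframe, with \<open>g\<^sup>i\<^sup>i = \<eta>\<^sub>i\<close>, both factors of
  \<open>e\<^sup>J \<and>\<^sub>l e\<^sup>J\<close> are contracted with the same \<open>e\<^sub>i\<close>, so this sign occurs twice and disappears: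
  \<open>e\<^sup>J \<and>\<^sub>l\<^sub>+\<^sub>1 e\<^sup>J\<close> is the sum over \<open>i\<close> in \<open>J\<close> of \<open>\<eta>\<^sub>i (e\<^sup>J\<^sup>-\<^sup>i \<and>\<^sub>l e\<^sup>J\<^sup>-\<^sup>i)\<close>.  The recursion ends with ordinary exterior
  squares, and \<open>e\<^sup>K \<and> e\<^sup>K\<close> is \<open>0\<close> unless \<open>K\<close> is empty, because some factor is repeated.  Hence
  \<open>e\<^sup>J \<and>\<^sub>l e\<^sup>J\<close> vanishes for \<open>l < |J|\<close>, and for \<open>l = |J|\<close> it is \<open>l!\<close> times the product of the \<open>\<eta>\<^sub>j\<close>
  (\<open>contracted_wedge_coframe_monomial_self\<close>).

  So only the term \<open>l = n\<close> of the Graf square of the volume form survives.  There the factorials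
  cancel and the result is \<open>(-1)\<^bsup>[n/2]\<^esup> (-1)\<^sup>q\<close>.  Since \<open>n = (p - q) + 2q\<close>, the exponent \<open>[n/2] + q\<close> has
  the parity of the integer part of \<open>(p - q)/2\<close>, which is even exactly if \<open>p - q\<close> is \<open>0\<close> or \<open>1\<close>
  modulo \<open>4\<close>.

  The rules of exterior algebra needed for this are associativity and anticommutativity for products
  whose first factor is a 1-form.  The value of a form on \<open>v # vs\<close> is the value on \<open>vs\<close> of its
  contraction with the constant field \<open>v\<close>, so these identities follow from the Leibniz rule for
  contractions by induction on the list of arguments; no sums over shuffles have to be rearranged.
\<close>

section \<open>Bilinearity and degree of the exterior product\<close>

lemma sum_dform_apply: "(\<Sum>i\<in>I. f i) x vs = (\<Sum>i\<in>I. (f i :: 'a dform) x vs)"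
  by (induction I rule: infinite_finite_induct) auto

lemma fscale_apply [simp]: "fscale c \<omega> x vs = c x * \<omega> x vs"
  by (simp add: fscale_def scale_def)

lemma fscale_zero [simp]: "fscale c 0 = 0"
  by (simp add: fun_eq_iff)

lemma contract_zero [simp]: "contract X 0 = 0"
  by (simp add: contract_def fun_eq_iff)

lemma wedge_zero [simp]: "wedge 0 \<beta> = 0" "wedge \<alpha> 0 = 0"
  by (simp_all add: wedge_def fun_eq_iff)

lemma wedge_add: "wedge (\<alpha> + \<alpha>') \<beta> = wedge \<alpha> \<beta> + wedge \<alpha>' \<beta>"
  "wedge \<alpha> (\<beta> + \<beta>') = wedge \<alpha> \<beta> + wedge \<alpha> \<beta>'"
  by (simp_all add: wedge_def fun_eq_iff algebra_simps sum.distrib)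

lemma wedge_fscale: "wedge (fscale c \<alpha>) \<beta> = fscale c (wedge \<alpha> \<beta>)"
  "wedge \<alpha> (fscale c \<beta>) = fscale c (wedge \<alpha> \<beta>)"
  by (simp_all add: wedge_def fun_eq_iff sum_distrib_left mult.assoc mult.left_commute)

lemma wedge_Nil: "wedge \<alpha> \<beta> x [] = \<alpha> x [] * \<beta> x []"
  by (simp add: wedge_def inversions_def)

lemma form_degree_wedge:
  assumes "form_degree k \<alpha>" "form_degree l \<beta>"
  shows "form_degree (k + l) (wedge \<alpha> \<beta>)"
  unfolding form_degree_def wedge_def
proof (intro allI impI sum.neutral ballI)
  fix x and vs :: "'a tvec list" and S
  assume len: "length vs \<noteq> k + l" and S: "S \<in> Pow {..<length vs}"
  have "{i. i < length vs \<and> i \<in> S} = S" "{i. i < length vs \<and> i \<in> - S} = {..<length vs} - S"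
    using S by auto
  then have "length (nths vs S) = card S" "length (nths vs (- S)) = length vs - card S"
    using S by (auto simp: length_nths card_Diff_subset finite_subset)
  moreover have "card S \<le> length vs"
    using S card_mono[of "{..<length vs}" S] by auto
  ultimately have "length (nths vs S) \<noteq> k \<or> length (nths vs (- S)) \<noteq> l"
    using len by auto
  then show "(-1) ^ card (inversions (length vs) S) * \<alpha> x (nths vs S) * \<beta> x (nths vs (- S)) = 0"
    using assms by (auto simp: form_degree_def)
qed

section \<open>Exterior multiplication by a 1-form\<close>

text \<open>
  By the Leibniz rule, contraction passes a factor of degree 0 unchanged, which reduces the product to
  its value on the empty list.
\<close>

lemma wedge_0_form:
  assumes "form_degree 0 \<gamma>"
  shows "wedge \<gamma> \<beta> = fscale (\<lambda>x. \<gamma> x []) \<beta>"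
proof -
  have "wedge \<gamma> \<beta> x vs = \<gamma> x [] * \<beta> x vs" for x vs
  proof (induction vs arbitrary: \<beta>)
    case (Cons v vs)
    have "wedge \<gamma> \<beta> x (v # vs) = contract (\<lambda>_. v) (wedge \<gamma> \<beta>) x vs"
      by (simp add: contract_def)
    also have "\<dots> = wedge \<gamma> (contract (\<lambda>_. v) \<beta>) x vs"
      by (simp add: contract_wedge[OF assms] contract_0_form[OF assms])
    finally show ?case by (simp add: Cons) (simp add: contract_def)
  qed (simp add: wedge_Nil)
  then show ?thesis by (simp add: fun_eq_iff)
qed

lemma contract_wedge_1_form:
  assumes "form_degree 1 a"
  shows "contract X (wedge a \<beta>) =
    fscale (\<lambda>x. a x [X x]) \<beta> + fscale (\<lambda>_. -1) (wedge a (contract X \<beta>))"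
proof -
  have "form_degree 0 (contract X a)" using assms contract_degree[of 0] by simp
  then show ?thesis
    by (simp add: contract_wedge[OF assms] wedge_0_form) (simp add: contract_def)
qed

text \<open>
  The evaluated form of the Leibniz rule; it drives the inductions on the list of arguments.
\<close>

lemma wedge_1_form_Cons:
  assumes "form_degree 1 a"
  shows "wedge a \<beta> x (v # vs) = a x [v] * \<beta> x vs - wedge a (contract (\<lambda>_. v) \<beta>) x vs"
proof -
  have "wedge a \<beta> x (v # vs) = contract (\<lambda>_. v) (wedge a \<beta>) x vs"
    by (simp add: contract_def)
  then show ?thesis by (simp add: contract_wedge_1_form[OF assms])
qed

text \<open>
  Contracting either side with \<open>v\<close> gives \<open>a(v) \<alpha> \<and> \<beta>\<close> and two products of the same shape with \<open>\<alpha>\<close> or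
  \<open>\<beta>\<close> contracted.  The degree of \<open>\<alpha>\<close> must vary in the induction, as contraction lowers it.
\<close>

lemma wedge_1_form_assoc:
  assumes a: "form_degree 1 a" and \<alpha>: "form_degree k \<alpha>"
  shows "wedge (wedge a \<alpha>) \<beta> = wedge a (wedge \<alpha> \<beta>)"
proof -
  have "wedge (wedge a \<alpha>) \<beta> x vs = wedge a (wedge \<alpha> \<beta>) x vs" for x vs
    using \<alpha>
  proof (induction vs arbitrary: k \<alpha> \<beta>)
    case Nil
    show ?case using a by (simp add: wedge_Nil form_degree_def)
  next
    case (Cons v vs)
    let ?i = "contract (\<lambda>_. v)"
    have IH: "wedge (wedge a (?i \<alpha>)) \<beta> x vs = wedge a (wedge (?i \<alpha>) \<beta>) x vs"
    proof (cases k)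
      case 0
      then show ?thesis using Cons.prems by (simp add: contract_0_form)
    next
      case (Suc k')
      then show ?thesis using Cons.IH[of k'] Cons.prems contract_degree by blast
    qed
    have deg: "form_degree (1 + k) (wedge a \<alpha>)"
      by (rule form_degree_wedge[OF a Cons.prems])
    have "wedge (wedge a \<alpha>) \<beta> x (v # vs) = ?i (wedge (wedge a \<alpha>) \<beta>) x vs"
      by (simp add: contract_def)
    also have "\<dots> = a x [v] * wedge \<alpha> \<beta> x vs - wedge (wedge a (?i \<alpha>)) \<beta> x vs
        - (-1) ^ k * wedge (wedge a \<alpha>) (?i \<beta>) x vs"
      by (simp add: contract_wedge[OF deg] contract_wedge_1_form[OF a] wedge_add wedge_fscale)
    also have "\<dots> = wedge a (wedge \<alpha> \<beta>) x (v # vs)"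
      by (simp add: IH Cons.IH[OF Cons.prems] wedge_1_form_Cons[OF a] contract_wedge[OF Cons.prems]
        wedge_add wedge_fscale)
    finally show ?case .
  qed
  then show ?thesis by (simp add: fun_eq_iff)
qed

text \<open>
  Contracting \<open>a \<and> b \<and> \<beta>\<close> with \<open>v\<close> gives \<open>a(v) b \<and> \<beta> - b(v) a \<and> \<beta>\<close>, which is antisymmetric in \<open>a\<close> and
  \<open>b\<close>, plus \<open>a \<and> b\<close> multiplied with the contraction of \<open>\<beta>\<close>.
\<close>

lemma wedge_1_form_anticommute:
  assumes a: "form_degree 1 a" and b: "form_degree 1 b"
  shows "wedge a (wedge b \<beta>) = - wedge b (wedge a \<beta>)"
proof -
  have "wedge a (wedge b \<beta>) x vs = - wedge b (wedge a \<beta>) x vs" for x vs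
  proof (induction vs arbitrary: \<beta>)
    case Nil
    show ?case using a b by (simp add: wedge_Nil form_degree_def)
  next
    case (Cons v vs)
    then show ?case
      by (simp add: wedge_1_form_Cons[OF a] wedge_1_form_Cons[OF b] contract_wedge_1_form[OF a]
        contract_wedge_1_form[OF b] wedge_add wedge_fscale)
  qed
  then show ?thesis by (simp add: fun_eq_iff)
qed

lemma wedge_1_form_nilpotent:
  assumes "form_degree 1 a"
  shows "wedge a (wedge a \<beta>) = 0"
proof -
  have "wedge a (wedge a \<beta>) x vs = - wedge a (wedge a \<beta>) x vs" for x vs
    using wedge_1_form_anticommute[OF assms assms, of \<beta>] by (metis fun_Compl_def)
  then show ?thesis by (simp add: fun_eq_iff)
qed

section \<open>Monomials in a coframe\<close>

definition coframe_monomial :: "'a set \<Rightarrow> (nat \<Rightarrow> 'a dform) \<Rightarrow> nat list \<Rightarrow> 'a dform" where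
  "coframe_monomial U e J = foldr wedge (map e J) (unit_form U)"

lemma coframe_monomial_simps [simp]:
  "coframe_monomial U e [] = unit_form U"
  "coframe_monomial U e (j # J) = wedge (e j) (coframe_monomial U e J)"
  by (simp_all add: coframe_monomial_def)

lemma form_degree_unit_form: "form_degree 0 (unit_form U)"
  by (simp add: form_degree_def unit_form_def)

lemma local_coframe_degree:
  assumes "local_coframe n A U e" "j \<in> {1..n}"
  shows "form_degree 1 (e j)"
  using assms by (auto simp: local_coframe_def)

lemma form_degree_coframe_monomial:
  assumes "local_coframe n A U e" "set J \<subseteq> {1..n}"
  shows "form_degree (length J) (coframe_monomial U e J)"
  using assms(2)
proof (induction J)
  case Nil
  show ?case by (simp add: form_degree_unit_form)
next
  case (Cons j J)
  then show ?case
    using form_degree_wedge[OF local_coframe_degree[OF assms(1)], of j "length J"] by simp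
qed

lemma coframe_monomial_outside:
  assumes "local_coframe n A U e" "set J \<subseteq> {1..n}" "x \<notin> U"
  shows "coframe_monomial U e J x = 0"
proof (cases J)
  case Nil
  then show ?thesis using assms by (simp add: unit_form_def fun_eq_iff)
next
  case (Cons j J')
  then have "e j x = 0" using assms by (auto simp: local_coframe_def diff_forms_def)
  then show ?thesis by (simp add: Cons wedge_def fun_eq_iff)
qed

text \<open>
  The unit form is the indicator function of \<open>U\<close>, so it is neutral only for forms that vanish outside
  \<open>U\<close>.
\<close>

lemma unit_form_wedge_coframe_monomial:
  assumes "local_coframe n A U e" "set J \<subseteq> {1..n}"
  shows "wedge (unit_form U) (coframe_monomial U e J) = coframe_monomial U e J"
proof (intro ext)
  fix x vs
  show "wedge (unit_form U) (coframe_monomial U e J) x vs = coframe_monomial U e J x vs"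
    using coframe_monomial_outside[OF assms, of x]
    by (simp add: wedge_0_form[OF form_degree_unit_form]) (simp add: unit_form_def)
qed

lemma wedge_coframe_monomials:
  assumes e: "local_coframe n A U e" and "set J \<subseteq> {1..n}" "set K \<subseteq> {1..n}"
  shows "wedge (coframe_monomial U e J) (coframe_monomial U e K) = coframe_monomial U e (J @ K)"
  using assms(2)
proof (induction J)
  case Nil
  show ?case using unit_form_wedge_coframe_monomial[OF e assms(3)] by simp
next
  case (Cons j J)
  then show ?case
    using wedge_1_form_assoc[OF local_coframe_degree[OF e] form_degree_coframe_monomial[OF e], of j J]
    by simp
qed

text \<open>
  Anticommutativity moves \<open>e\<^sup>j\<close> to the place where it meets its copy in the monomial.
\<close>

lemma wedge_coframe_monomial_repeated:
  assumes e: "local_coframe n A U e" and "set J \<subseteq> {1..n}" "j \<in> set J"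
  shows "wedge (e j) (coframe_monomial U e J) = 0"
  using assms(2,3)
proof (induction J)
  case (Cons i J)
  have deg: "form_degree 1 (e i)" "form_degree 1 (e j)"
    by (rule local_coframe_degree[OF e]; use Cons.prems in auto)+
  show "wedge (e j) (coframe_monomial U e (i # J)) = 0"
  proof (cases "i = j")
    case True
    then show ?thesis using wedge_1_form_nilpotent[OF deg(2)] by simp
  next
    case False
    have "wedge (e j) (coframe_monomial U e J) = 0"
      by (rule Cons.IH) (use Cons.prems False in auto)
    then show ?thesis
      by (simp add: wedge_1_form_anticommute[OF deg(2,1)])
  qed
qed simp

lemma coframe_monomial_not_distinct:
  assumes e: "local_coframe n A U e" and "set J \<subseteq> {1..n}" "\<not> distinct J"
  shows "coframe_monomial U e J = 0"
  using assms(2,3)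
  by (induction J) (auto simp: wedge_coframe_monomial_repeated[OF e])

lemma contract_coframe_monomial_notin:
  assumes e: "local_coframe n A U e" and E: "dual_frame n A U e E" and i: "i \<in> {1..n}"
    and "set J \<subseteq> {1..n}" "i \<notin> set J"
  shows "contract (E i) (coframe_monomial U e J) = 0"
  using assms(4,5)
proof (induction J)
  case Nil
  show ?case by (simp add: contract_0_form form_degree_unit_form)
next
  case (Cons j J)
  have j: "j \<in> {1..n}" "i \<noteq> j" using Cons.prems by auto
  have "contract (E i) (coframe_monomial U e J) = 0"
    by (rule Cons.IH) (use Cons.prems in auto)
  then show "contract (E i) (coframe_monomial U e (j # J)) = 0"
    using j by (simp add: contract_wedge[OF local_coframe_degree[OF e]] contract_coframe[OF e E i])
qed

text \<open>
  The sign is \<open>(-1)\<^sup>k\<close> with \<open>k\<close> the number of entries before \<open>i\<close>.  Only its square enters the products of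
  a monomial with itself, so the position is not recorded.
\<close>

lemma contract_coframe_monomial_in:
  assumes e: "local_coframe n A U e" and E: "dual_frame n A U e E"
    and "set J \<subseteq> {1..n}" "distinct J" "i \<in> set J"
  shows "\<exists>s. s * s = 1 \<and> contract (E i) (coframe_monomial U e J) =
    fscale (\<lambda>_. s) (coframe_monomial U e (remove1 i J))"
  using assms(3-)
proof (induction J)
  case (Cons j J)
  have ij: "i \<in> {1..n}" "j \<in> {1..n}" using Cons.prems by auto
  note c = contract_wedge[OF local_coframe_degree[OF e ij(2)], of "E i"] contract_coframe[OF e E ij]
  show ?case
  proof (cases "i = j")
    case True
    have "contract (E i) (coframe_monomial U e J) = 0"
      using Cons.prems True ij by (intro contract_coframe_monomial_notin[OF e E]) auto
    then have "contract (E i) (coframe_monomial U e (j # J)) = coframe_monomial U e J"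
      using Cons.prems True unit_form_wedge_coframe_monomial[OF e, of J]
      by (simp add: c[unfolded True])
    then show ?thesis using True by (intro exI[of _ 1]) (simp add: fun_eq_iff)
  next
    case False
    have "\<exists>s. s * s = 1 \<and> contract (E i) (coframe_monomial U e J) =
        fscale (\<lambda>_. s) (coframe_monomial U e (remove1 i J))"
      by (rule Cons.IH) (use Cons.prems False in auto)
    then obtain s where s: "s * s = 1" "contract (E i) (coframe_monomial U e J) =
        fscale (\<lambda>_. s) (coframe_monomial U e (remove1 i J))"
      by blast
    have "contract (E i) (coframe_monomial U e (j # J)) =
        fscale (\<lambda>_. - s) (coframe_monomial U e (remove1 i (j # J)))"
      using False by (simp add: c s(2) wedge_fscale) (simp add: fun_eq_iff)
    then show ?thesis using s(1) by (intro exI[of _ "- s"]) simp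
  qed
qed simp

section \<open>Contracted wedge products of a monomial with itself\<close>

lemma contracted_wedge_zero [simp]:
  "contracted_wedge n A g e E l 0 \<beta> = 0" "contracted_wedge n A g e E l \<alpha> 0 = 0"
  by (induction l arbitrary: \<alpha> \<beta>) simp_all

lemma contracted_wedge_outside:
  assumes "\<alpha> x = 0"
  shows "contracted_wedge n A g e E l \<alpha> \<beta> x = 0"
  using assms
proof (induction l arbitrary: \<alpha> \<beta>)
  case 0
  then show ?case by (simp add: wedge_def fun_eq_iff)
next
  case (Suc l)
  then have "contract (E i) \<alpha> x = 0" for i by (simp add: contract_def fun_eq_iff)
  then show ?case using Suc.IH by (simp add: sum_dform_apply fun_eq_iff)
qed

lemma contracted_wedge_fscale:
  "contracted_wedge n A g e E l (fscale (\<lambda>_. c) \<alpha>) (fscale (\<lambda>_. d) \<beta>) =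
    fscale (\<lambda>_. c * d) (contracted_wedge n A g e E l \<alpha> \<beta>)"
proof (induction l arbitrary: \<alpha> \<beta>)
  case 0
  have "wedge (fscale (\<lambda>_. c) \<alpha>) (fscale (\<lambda>_. d) \<beta>) = fscale (\<lambda>_. c * d) (wedge \<alpha> \<beta>)"
    by (simp add: wedge_fscale fun_eq_iff)
  then show ?case unfolding contracted_wedge.simps .
next
  case (Suc l)
  have IH: "contracted_wedge n A g e E l (fscale (\<lambda>_. c) \<alpha>) (fscale (\<lambda>_. d) \<beta>) =
      fscale (\<lambda>_. c * d) (contracted_wedge n A g e E l \<alpha> \<beta>)" for \<alpha> \<beta>
    by (rule Suc.IH)
  show "contracted_wedge n A g e E (Suc l) (fscale (\<lambda>_. c) \<alpha>) (fscale (\<lambda>_. d) \<beta>) =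
      fscale (\<lambda>_. c * d) (contracted_wedge n A g e E (Suc l) \<alpha> \<beta>)"
    by (simp add: IH contract_linear sum_dform_apply fun_eq_iff sum_distrib_left mult.left_commute)
qed

text \<open>
  The orthogonality relations hold at the points of \<open>U\<close> only.  The identity of forms extends to all
  points because both sides vanish where the first factor does.
\<close>

lemma contracted_wedge_Suc_orthogonal:
  assumes cometric: "\<And>x i j. x \<in> U \<Longrightarrow> i \<in> {1..n} \<Longrightarrow> j \<in> {1..n} \<Longrightarrow>
      cometric n A g x (e i x) (e j x) = (if i = j then \<eta> i else 0)"
    and outside: "\<And>x. x \<notin> U \<Longrightarrow> \<alpha> x = 0"
  shows "contracted_wedge n A g e E (Suc l) \<alpha> \<beta> =
    (\<Sum>i=1..n. fscale (\<lambda>_. \<eta> i)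
      (contracted_wedge n A g e E l (contract (E i) \<alpha>) (contract (E i) \<beta>)))"
proof (intro ext)
  fix x vs
  let ?w = "\<lambda>i j. contracted_wedge n A g e E l (contract (E i) \<alpha>) (contract (E j) \<beta>) x vs"
  have "?w i j = 0" if "x \<notin> U" for i j
    using contracted_wedge_outside[of "contract (E i) \<alpha>" x] outside[OF that]
    by (simp add: contract_def fun_eq_iff)
  then have "cometric n A g x (e i x) (e j x) * ?w i j = (if i = j then \<eta> i * ?w i j else 0)"
    if "i \<in> {1..n}" "j \<in> {1..n}" for i j
    using cometric[OF _ that] by (cases "x \<in> U") auto
  then have "(\<Sum>i=1..n. \<Sum>j=1..n. cometric n A g x (e i x) (e j x) * ?w i j) =
      (\<Sum>i=1..n. \<Sum>j=1..n. if i = j then \<eta> i * ?w i j else 0)"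
    by (intro sum.cong refl)
  also have "\<dots> = (\<Sum>i=1..n. \<eta> i * ?w i i)"
    by (intro sum.cong) auto
  finally show "contracted_wedge n A g e E (Suc l) \<alpha> \<beta> x vs = (\<Sum>i=1..n. fscale (\<lambda>_. \<eta> i)
      (contracted_wedge n A g e E l (contract (E i) \<alpha>) (contract (E i) \<beta>))) x vs"
    by (simp add: sum_dform_apply)
qed

text \<open>
  Each of the \<open>|J|\<close> choices of \<open>i\<close> in \<open>J\<close> contributes \<open>\<eta>\<^sub>i\<close> times the value for \<open>J\<close> without \<open>i\<close>, and this
  product is the same for all \<open>i\<close>.  For \<open>l + 1 = |J|\<close> the number of choices turns \<open>l!\<close> into
  \<open>(l + 1)!\<close>.
\<close>

lemma contracted_wedge_coframe_monomial_self:
  assumes e: "local_coframe n A U e" and E: "dual_frame n A U e E"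
    and cometric: "\<And>x i j. x \<in> U \<Longrightarrow> i \<in> {1..n} \<Longrightarrow> j \<in> {1..n} \<Longrightarrow>
      cometric n A g x (e i x) (e j x) = (if i = j then \<eta> i else 0)"
    and "set J \<subseteq> {1..n}" "distinct J" "l \<le> length J"
  shows "contracted_wedge n A g e E l (coframe_monomial U e J) (coframe_monomial U e J) =
    (if l < length J then 0 else fscale (\<lambda>_. fact l * prod \<eta> (set J)) (unit_form U))"
  using assms(4-)
proof (induction l arbitrary: J)
  case 0
  show ?case
  proof (cases J)
    case Nil
    then show ?thesis
      using unit_form_wedge_coframe_monomial[OF e, of "[]"] by (simp add: fun_eq_iff)
  next
    case (Cons j J')
    then show ?thesis
      using 0 by (simp add: wedge_coframe_monomials[OF e] coframe_monomial_not_distinct[OF e]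
        del: coframe_monomial_simps)
  qed
next
  case (Suc l)
  let ?cw = "contracted_wedge n A g e E"
  let ?W = "\<lambda>i. fscale (\<lambda>_. \<eta> i) (?cw l (contract (E i) (coframe_monomial U e J))
    (contract (E i) (coframe_monomial U e J)))"
  \<comment> \<open>The contribution of each index in \<open>J\<close>, independent of the index.\<close>
  let ?c = "if Suc l < length J then 0 else fscale (\<lambda>_. fact l * prod \<eta> (set J)) (unit_form U)"
  have W0: "?W i = 0" if "i \<in> {1..n} - set J" for i
    using that Suc.prems contract_coframe_monomial_notin[OF e E, of i J] by simp
  have W: "?W i = ?c" if i: "i \<in> set J" for i
  proof -
    obtain s where s: "s * s = 1" "contract (E i) (coframe_monomial U e J) =
        fscale (\<lambda>_. s) (coframe_monomial U e (remove1 i J))"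
      using contract_coframe_monomial_in[OF e E Suc.prems(1,2) i] by blast
    have set: "set (remove1 i J) = set J - {i}" using Suc.prems by simp
    have len: "length (remove1 i J) = length J - 1" using i by (simp add: length_remove1)
    have cw: "?cw l (coframe_monomial U e (remove1 i J)) (coframe_monomial U e (remove1 i J)) =
        (if l < length J - 1 then 0
         else fscale (\<lambda>_. fact l * prod \<eta> (set J - {i})) (unit_form U))"
      unfolding set[symmetric] len[symmetric]
      by (rule Suc.IH) (use Suc.prems set len in auto)
    have "?W i = fscale (\<lambda>_. \<eta> i)
        (?cw l (coframe_monomial U e (remove1 i J)) (coframe_monomial U e (remove1 i J)))"
      by (simp add: s contracted_wedge_fscale fun_eq_iff)
    also have "\<dots> = fscale (\<lambda>_. \<eta> i) (if l < length J - 1 then 0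
        else fscale (\<lambda>_. fact l * prod \<eta> (set J - {i})) (unit_form U))"
      by (simp only: cw)
    also have "\<dots> = ?c"
      using i by (auto simp: prod.remove[of "set J" i] fun_eq_iff)
    finally show ?thesis .
  qed
  have "?cw (Suc l) (coframe_monomial U e J) (coframe_monomial U e J) = (\<Sum>i=1..n. ?W i)"
    using coframe_monomial_outside[OF e Suc.prems(1)]
    by (intro contracted_wedge_Suc_orthogonal[of U] cometric) auto
  also have "\<dots> = (\<Sum>i\<in>set J. ?W i)"
    using Suc.prems W0 by (intro sum.mono_neutral_right) auto
  also have "\<dots> = (\<Sum>i\<in>set J. ?c)"
    using W by (intro sum.cong refl)
  also have "\<dots> = (if Suc l < length J then 0
      else fscale (\<lambda>_. fact (Suc l) * prod \<eta> (set J)) (unit_form U))"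
  proof (cases "Suc l < length J")
    case False
    then have "card (set J) = Suc l" using Suc.prems distinct_card[of J] by simp
    then show ?thesis using False by (simp add: fun_eq_iff sum_dform_apply algebra_simps)
  qed (simp add: fun_eq_iff sum_dform_apply)
  finally show ?case .
qed

section \<open>The Graf square of the volume form\<close>

lemma degree_part_homogeneous:
  assumes "form_degree k \<omega>"
  shows "degree_part r \<omega> = (if r = k then \<omega> else 0)"
  using assms by (auto simp: degree_part_def form_degree_def fun_eq_iff)

lemma graf_homogeneous_zero [simp]:
  "graf_homogeneous n A g e E r s 0 \<beta> = 0" "graf_homogeneous n A g e E r s \<alpha> 0 = 0"
  by (simp_all add: graf_homogeneous_def)

lemma graf_product_homogeneous:
  assumes "form_degree r \<alpha>" "form_degree s \<beta>" "r \<le> n" "s \<le> n"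
  shows "graf_product n A g e E \<alpha> \<beta> = graf_homogeneous n A g e E r s \<alpha> \<beta>"
proof -
  have "graf_product n A g e E \<alpha> \<beta> =
      (\<Sum>r'=0..n. \<Sum>s'=0..n. if r' = r then if s' = s then graf_homogeneous n A g e E r s \<alpha> \<beta> else 0 else 0)"
    unfolding graf_product_def
    by (intro sum.cong refl) (auto simp: degree_part_homogeneous[OF assms(1)] degree_part_homogeneous[OF assms(2)])
  also have "\<dots> = (\<Sum>r'=0..n. if r' = r then graf_homogeneous n A g e E r s \<alpha> \<beta> else 0)"
    using assms by (intro sum.cong refl) auto
  finally show ?thesis using assms by simp
qed

text \<open>
  In the remaining term \<open>l = n\<close> the exponent \<open>l (n - l)\<close> is \<open>0\<close>, which leaves the sign
  \<open>(-1)\<^bsup>[n/2]\<^esup>\<close>.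
\<close>

lemma graf_square_volume_form:
  assumes e: "local_coframe n A U e" and E: "dual_frame n A U e E"
    and cometric: "\<And>x i j. x \<in> U \<Longrightarrow> i \<in> {1..n} \<Longrightarrow> j \<in> {1..n} \<Longrightarrow>
      cometric n A g x (e i x) (e j x) = (if i = j then \<eta> i else 0)"
  shows "graf_product n A g e E (volume_form n U e) (volume_form n U e) =
    fscale (\<lambda>_. (-1) ^ (n div 2) * (\<Prod>i=1..n. \<eta> i)) (unit_form U)"
proof -
  let ?J = "[1..<Suc n]"
  let ?v = "volume_form n U e"
  let ?w = "\<lambda>l. contracted_wedge n A g e E l ?v ?v"
  have J: "set ?J = {1..n}" "distinct ?J" "length ?J = n" by auto
  have v: "?v = coframe_monomial U e ?J"
    by (simp only: volume_form_def coframe_monomial_def)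
  have deg: "form_degree n ?v"
    using form_degree_coframe_monomial[OF e, of ?J] J unfolding v by simp
  have w: "?w l = (if l < n then 0 else fscale (\<lambda>_. fact l * (\<Prod>i=1..n. \<eta> i)) (unit_form U))"
    if "l \<le> n" for l
    using contracted_wedge_coframe_monomial_self[OF e E cometric, of ?J l] J that
    unfolding v by simp
  have "graf_product n A g e E ?v ?v =
      (\<Sum>l=0..n. fscale (\<lambda>_. (-1) ^ (l * (n - l) + l div 2) / fact l) (?w l))"
    by (simp add: graf_product_homogeneous[OF deg deg] graf_homogeneous_def)
  also have "\<dots> = (\<Sum>l\<in>{n}. fscale (\<lambda>_. (-1) ^ (l * (n - l) + l div 2) / fact l) (?w l))"
    by (intro sum.mono_neutral_right) (auto simp: w)
  also have "\<dots> = fscale (\<lambda>_. (-1) ^ (n div 2) * (\<Prod>i=1..n. \<eta> i)) (unit_form U)"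
    by (simp add: w fun_eq_iff)
  finally show ?thesis .
qed

lemma prod_signature_signs: "(\<Prod>i=1..p+q. if i \<le> p then 1 else - 1 :: real) = (-1) ^ q"
  by (induction q) (auto intro!: prod.neutral)

lemma signature_parity: "even ((p + q) div 2 + q) \<longleftrightarrow> (int p - int q) mod 4 \<in> {0, 1}"
proof -
  define d where "d = int p - int q"
  have "int p + int q = d + int q * 2" by (simp add: d_def)
  then have "(int p + int q) div 2 = d div 2 + int q" by simp
  then have "int ((p + q) div 2 + q) = d div 2 + 2 * int q" by (simp add: zdiv_int)
  then have "even (int ((p + q) div 2 + q)) \<longleftrightarrow> even (d div 2)" by simp
  moreover have "even (d div 2) \<longleftrightarrow> d mod 4 = 0 \<or> d mod 4 = 1" by presburger
  ultimately show ?thesis by (simp add: d_def)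
qed

lemma residues_mod_4_mod_8:
  fixes d :: int
  shows "d mod 4 \<in> {0, 1} \<longleftrightarrow> d mod 8 \<in> {0, 1, 4, 5}"
    and "d mod 4 \<in> {2, 3} \<longleftrightarrow> d mod 8 \<in> {2, 3, 6, 7}"
proof -
  have "d mod 4 = d mod 8 mod 4" by (simp add: mod_mod_cancel)
  moreover have "d mod 8 \<in> {0..7}" by simp
  then have "d mod 8 \<in> {0, 1, 2, 3, 4, 5, 6, 7}"
    by (simp only: atLeastAtMost_iff insert_iff empty_iff) linarith
  ultimately show "d mod 4 \<in> {0, 1} \<longleftrightarrow> d mod 8 \<in> {0, 1, 4, 5}"
    and "d mod 4 \<in> {2, 3} \<longleftrightarrow> d mod 8 \<in> {2, 3, 6, 7}"
    by auto
qed

theorem proposition3p9: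
  fixes M :: "'a topology" and A :: "'a atlas" and g :: "'a \<Rightarrow> 'a tvec \<Rightarrow> 'a tvec \<Rightarrow> real"
    and p q n :: nat and U :: "'a set"
    and e :: "nat \<Rightarrow> 'a dform" and E :: "nat \<Rightarrow> 'a vfield" and \<v> :: "'a dform"
  assumes "n = p + q"
    and "smooth_manifold M n A" and "paracompact_space M" and "connected_space M"
    and "pseudo_riemannian_metric M A p q g"
    and "openin M U"
    and "orthonormal_coframe p q A g U e"
    and "dual_frame n A U e E"
    and "\<v> = volume_form n U e"
  shows "((int p - int q) mod 4 \<in> {0, 1} \<longrightarrow> graf_product n A g e E \<v> \<v> = unit_form U) \<and>
    ((int p - int q) mod 4 \<in> {2, 3} \<longrightarrow> graf_product n A g e E \<v> \<v> = - unit_form U) \<and>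
    ((int p - int q) mod 4 \<in> {0, 1} \<longleftrightarrow> (int p - int q) mod 8 \<in> {0, 1, 4, 5}) \<and>
    ((int p - int q) mod 4 \<in> {2, 3} \<longleftrightarrow> (int p - int q) mod 8 \<in> {2, 3, 6, 7})"
proof -
  define \<eta> :: "nat \<Rightarrow> real" where "\<eta> i = (if i \<le> p then 1 else - 1)" for i
  have e: "local_coframe n A U e"
    using assms(1,7) by (simp add: orthonormal_coframe_def)
  have cometric: "cometric n A g x (e i x) (e j x) = (if i = j then \<eta> i else 0)"
      if "x \<in> U" "i \<in> {1..n}" "j \<in> {1..n}" for x i j
    using assms(1,7) that by (auto simp: orthonormal_coframe_def \<eta>_def)
  have "graf_product n A g e E \<v> \<v> =
      fscale (\<lambda>_. (-1) ^ (n div 2) * (\<Prod>i=1..n. \<eta> i)) (unit_form U)"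
    unfolding assms(9) by (rule graf_square_volume_form[OF e assms(8) cometric])
  also have "\<dots> = fscale (\<lambda>_. (-1) ^ ((p + q) div 2 + q)) (unit_form U)"
    unfolding assms(1) \<eta>_def prod_signature_signs power_add ..
  also have "\<dots> = (if (int p - int q) mod 4 \<in> {0, 1} then unit_form U else - unit_form U)"
    unfolding signature_parity[symmetric] by (simp add: fun_eq_iff)
  finally have "graf_product n A g e E \<v> \<v> =
    (if (int p - int q) mod 4 \<in> {0, 1} then unit_form U else - unit_form U)" .
  then show ?thesis unfolding residues_mod_4_mod_8[symmetric] by auto
qed

end
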